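(* Let $X$ be a set, $K$ a positive definite kernel on $X\times X$, and $\mathcal{H}(K)$ its reproducing kernel Hilbert space. Let $m\in\mathbb{N}$, let $\{t_i\}_{i=1}^{m}$ be a finite subset of $X$, let $y=(y_i)_{i=1}^{m}\in\mathbb{R}^{m}$, let $\beta>0$, and let $K_m=(K(t_i,t_j))_{i,j=1}^{m}$ be the induced $m\times m$ sample matrix. Consider the problem of minimizing $$Q(f)=\sum_{i=1}^{m}|y_i-f(t_i)|^{2}+\beta\|f\|_{\mathcal{H}(K)}^{2},\qquad f\in\mathcal{H}(K).$$ Then the unique solution is $$F(\cdot)=\sum_{i=1}^{m}\big((K_m+\beta I_m)^{-1}y\big)_i\,K(\cdot,t_i)\quad\text{on }X,$$ i.e. $F=\arg\min Q$ on $\mathcal{H}(K)$, where $I_m$ is the $m\times m$ identity matrix.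
   Context: A positive definite kernel on a set $S$ is a function $K:S\times S\to\mathbb{C}$ with $\sum_{i,j=1}^{N}\overline{c_i}c_jK(x_i,x_j)\ge 0$ for all $N\in\mathbb{N}$, $x_1,\dots,x_N\in S$, $c_1,\dots,c_N\in\mathbb{C}$. Inner products are conjugate linear in the first variable. $\mathcal{H}(K)$ is the Hilbert space of functions on $S$ obtained by completing $\mathrm{span}\{K_x:=K(\cdot,x):x\in S\}$ in the inner product $\langle\sum c_iK_{x_i},\sum d_jK_{x_j}\rangle=\sum\overline{c_i}d_jK(x_i,x_j)$; it satisfies $f(x)=\langle K_x,f\rangle_{\mathcal{H}(K)}$ for $f\in\mathcal{H}(K)$, $x\in S$. *)

theory Defs
  imports "HOL-Analysis.Analysis"
begin

definition positive_definite_kernel :: "'a set \<Rightarrow> ('a \<Rightarrow> 'a \<Rightarrow> complex) \<Rightarrow> bool" where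
  "positive_definite_kernel X K \<longleftrightarrow>
     (\<forall>(N::nat) (x :: nat \<Rightarrow> 'a) (c :: nat \<Rightarrow> complex). (\<forall>i<N. x i \<in> X) \<longrightarrow>
        (\<Sum>i<N. \<Sum>j<N. cnj (c i) * c j * K (x i) (x j)) \<in> \<real>\<^sub>\<ge>\<^sub>0)"

text \<open>
  Functions on the set \<open>X\<close> are represented by total functions that vanish outside \<open>X\<close>; this
  makes the representation unique and keeps it closed under the pointwise operations.
\<close>

definition kernel_fun :: "'a set \<Rightarrow> ('a \<Rightarrow> 'a \<Rightarrow> complex) \<Rightarrow> 'a \<Rightarrow> 'a \<Rightarrow> complex" where
  "kernel_fun X K x = (\<lambda>z. if z \<in> X then K z x else 0)"

definition kernel_comb ::
    "'a set \<Rightarrow> ('a \<Rightarrow> 'a \<Rightarrow> complex) \<Rightarrow> 'a set \<Rightarrow> ('a \<Rightarrow> complex) \<Rightarrow> 'a \<Rightarrow> complex" where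
  "kernel_comb X K A c = (\<lambda>z. \<Sum>x\<in>A. c x * kernel_fun X K x z)"

definition kernel_span :: "'a set \<Rightarrow> ('a \<Rightarrow> 'a \<Rightarrow> complex) \<Rightarrow> ('a \<Rightarrow> complex) set" where
  "kernel_span X K = {kernel_comb X K A c | A c. finite A \<and> A \<subseteq> X}"

text \<open>
  The value below does not depend on the chosen representations: by the Hermitian symmetry of
  \<open>K\<close> it equals both \<open>\<Sum>x\<in>A. cnj (c x) * g x\<close> and \<open>\<Sum>y\<in>B. d y * cnj (f y)\<close>.
\<close>

definition span_inner ::
    "'a set \<Rightarrow> ('a \<Rightarrow> 'a \<Rightarrow> complex) \<Rightarrow> ('a \<Rightarrow> complex) \<Rightarrow> ('a \<Rightarrow> complex) \<Rightarrow> complex" where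
  "span_inner X K f g =
     (THE s. \<exists>A c B d. finite A \<and> A \<subseteq> X \<and> f = kernel_comb X K A c \<and>
                       finite B \<and> B \<subseteq> X \<and> g = kernel_comb X K B d \<and>
                       s = (\<Sum>x\<in>A. \<Sum>y\<in>B. cnj (c x) * d y * K x y))"

definition span_norm :: "'a set \<Rightarrow> ('a \<Rightarrow> 'a \<Rightarrow> complex) \<Rightarrow> ('a \<Rightarrow> complex) \<Rightarrow> real" where
  "span_norm X K f = sqrt (Re (span_inner X K f f))"

text \<open>
  The completion of the span is realised by functions.  Evaluation at a point is continuous on the
  span, so a Cauchy sequence in the span has a pointwise limit, and Cauchy sequences with the
  same pointwise limit are equivalent (their difference tends to 0 in norm).  Hence the classes of
  Cauchy sequences that make up the completion correspond one-to-one to their pointwise limits,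
  and the inner product of two limits is the limit of the inner products.
\<close>

definition rkhs_approx ::
    "'a set \<Rightarrow> ('a \<Rightarrow> 'a \<Rightarrow> complex) \<Rightarrow> (nat \<Rightarrow> 'a \<Rightarrow> complex) \<Rightarrow> ('a \<Rightarrow> complex) \<Rightarrow> bool" where
  "rkhs_approx X K u f \<longleftrightarrow>
     (\<forall>n. u n \<in> kernel_span X K) \<and>
     (\<forall>e>0. \<exists>N. \<forall>m\<ge>N. \<forall>n\<ge>N. span_norm X K (\<lambda>z. u m z - u n z) < e) \<and>
     (\<forall>z. (\<lambda>n. u n z) \<longlonglongrightarrow> f z)"

definition rkhs :: "'a set \<Rightarrow> ('a \<Rightarrow> 'a \<Rightarrow> complex) \<Rightarrow> ('a \<Rightarrow> complex) set" where
  "rkhs X K = {f. \<exists>u. rkhs_approx X K u f}"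

definition rkhs_inner ::
    "'a set \<Rightarrow> ('a \<Rightarrow> 'a \<Rightarrow> complex) \<Rightarrow> ('a \<Rightarrow> complex) \<Rightarrow> ('a \<Rightarrow> complex) \<Rightarrow> complex" where
  "rkhs_inner X K f g =
     (THE s. \<exists>u v. rkhs_approx X K u f \<and> rkhs_approx X K v g \<and>
                   (\<lambda>n. span_inner X K (u n) (v n)) \<longlonglongrightarrow> s)"

definition rkhs_norm :: "'a set \<Rightarrow> ('a \<Rightarrow> 'a \<Rightarrow> complex) \<Rightarrow> ('a \<Rightarrow> complex) \<Rightarrow> real" where
  "rkhs_norm X K f = sqrt (Re (rkhs_inner X K f f))"

definition sample_matrix ::
    "('a \<Rightarrow> 'a \<Rightarrow> complex) \<Rightarrow> ('m::finite \<Rightarrow> 'a) \<Rightarrow> complex ^ 'm ^ 'm" where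
  "sample_matrix K t = (\<chi> i j. K (t i) (t j))"

definition regularized_loss ::
    "'a set \<Rightarrow> ('a \<Rightarrow> 'a \<Rightarrow> complex) \<Rightarrow> ('m::finite \<Rightarrow> 'a) \<Rightarrow> real ^ 'm \<Rightarrow> real \<Rightarrow>
     ('a \<Rightarrow> complex) \<Rightarrow> real" where
  "regularized_loss X K t y \<beta> f =
     (\<Sum>i\<in>UNIV. (cmod (complex_of_real (y $ i) - f (t i)))\<^sup>2) + \<beta> * (rkhs_norm X K f)\<^sup>2"

end

theory Submission
  imports Defs
begin

text \<open>
  Write \<open>a = M\<^sup>-\<^sup>1 y\<close>, so that \<open>F = \<Sum>i. a\<^sub>i K(\<cdot>, t\<^sub>i)\<close>. The linear system
  \<open>(K\<^sub>m + \<beta> I) a = y\<close> says exactly that the residuals of \<open>F\<close> are \<open>y\<^sub>i - F (t\<^sub>i) = \<beta> a\<^sub>i\<close>. On the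
  other hand the reproducing property gives \<open>\<langle>F, h\<rangle> = \<Sum>i. cnj a\<^sub>i h (t\<^sub>i)\<close> for every \<open>h\<close> in the
  space. If \<open>Q (F + h)\<close> is expanded, the linear term of the data misfit and that of the penalty
  therefore cancel, and what remains is the identity
  \<open>Q (F + h) = Q F + (\<Sum>i. \<bar>h (t\<^sub>i)\<bar>\<^sup>2) + \<beta> \<parallel>h\<parallel>\<^sup>2\<close> (\<open>regularized_loss_expansion\<close>).
  So \<open>F\<close> is a minimizer, and it is the only one because the norm is definite. The matrix is invertible because \<open>M v = 0\<close> forces
  \<open>v\<^sup>* K\<^sub>m v + \<beta> \<parallel>v\<parallel>\<^sup>2 = 0\<close>.

  Only norms in the completion occur in this argument, and inner products of an element of the
  completion with one of the span. Hence it is enough to know that \<open>\<parallel>f\<parallel>\<^sup>2\<close> is the limit of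
  \<open>\<parallel>u\<^sub>n\<parallel>\<^sup>2\<close> for every sequence \<open>u\<close> in the span that represents \<open>f\<close> (\<open>rkhs_norm_sq_limit\<close>); the
  expansion is then carried out in the span and passes to the limit. The heart of that lemma is
  \<open>null_approx_norm\<close>: a Cauchy sequence in the span that tends to \<open>0\<close> pointwise tends to \<open>0\<close> in
  norm, so that different sequences representing the same function have the same limit norm.
\<close>

section \<open>The sesquilinear form of a positive definite kernel\<close>

locale pd_kernel =
  fixes X :: "'a set" and K :: "'a \<Rightarrow> 'a \<Rightarrow> complex"
  assumes pd: "positive_definite_kernel X K"
begin

lemma kernel_form_nonneg:
  assumes "finite I" "\<And>i. i \<in> I \<Longrightarrow> x i \<in> X"
  shows "(\<Sum>i\<in>I. \<Sum>j\<in>I. cnj (c i) * c j * K (x i) (x j)) \<in> \<real>\<^sub>\<ge>\<^sub>0"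
proof -
  obtain h where h: "bij_betw h {..<card I} I"
    using ex_bij_betw_nat_finite[OF assms(1)] by (auto simp: atLeast0LessThan)
  have "\<forall>i<card I. x (h i) \<in> X"
    using h assms(2) by (auto simp: bij_betw_def)
  then have "(\<Sum>i<card I. \<Sum>j<card I. cnj (c (h i)) * c (h j) * K (x (h i)) (x (h j))) \<in> \<real>\<^sub>\<ge>\<^sub>0"
    using pd[unfolded positive_definite_kernel_def, rule_format,
        of "card I" "\<lambda>i. x (h i)" "\<lambda>i. c (h i)"] by simp
  also have "(\<Sum>i<card I. \<Sum>j<card I. cnj (c (h i)) * c (h j) * K (x (h i)) (x (h j))) =
      (\<Sum>i<card I. \<Sum>j\<in>I. cnj (c (h i)) * c j * K (x (h i)) (x j))"
    by (intro sum.cong refl sum.reindex_bij_betw[OF h])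
  also have "\<dots> = (\<Sum>i\<in>I. \<Sum>j\<in>I. cnj (c i) * c j * K (x i) (x j))"
    by (rule sum.reindex_bij_betw[OF h])
  finally show ?thesis .
qed

text \<open>
  Over the complex numbers positivity already forces Hermitian symmetry: on two points, the
  coefficients \<open>(1, 1)\<close> show that \<open>K x y + K y x\<close> is real, and \<open>(1, \<i>)\<close> that
  \<open>\<i> (K x y - K y x)\<close> is real.
\<close>

lemma kernel_hermitian:
  assumes "x \<in> X" "y \<in> X"
  shows "K x y = cnj (K y x)"
proof -
  define p where "p i = (if i = 0 then x else y)" for i :: nat
  have diag: "K z z \<in> \<real>\<^sub>\<ge>\<^sub>0" if "z \<in> X" for z
    using kernel_form_nonneg[of "{0::nat}" "\<lambda>_. z" "\<lambda>_. 1"] that by simp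
  have two: "K x x + cnj b * K y x + b * K x y + cnj b * b * K y y \<in> \<real>\<^sub>\<ge>\<^sub>0" for b
    using kernel_form_nonneg[of "{0, 1::nat}" p "\<lambda>i. if i = 0 then 1 else b"] assms
    by (simp add: p_def algebra_simps)
  show ?thesis
    using two[of 1] two[of \<i>] diag[OF assms(1)] diag[OF assms(2)]
    by (auto simp: complex_nonneg_Reals_iff complex_eq_iff)
qed

lemma kernel_comb_in:
  "z \<in> X \<Longrightarrow> kernel_comb X K A c z = (\<Sum>x\<in>A. c x * K z x)"
  by (simp add: kernel_comb_def kernel_fun_def)

lemma kernel_span_outside:
  "f \<in> kernel_span X K \<Longrightarrow> z \<notin> X \<Longrightarrow> f z = 0"
  by (auto simp: kernel_span_def kernel_comb_def kernel_fun_def)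

lemma kernel_form_right:
  assumes "A \<subseteq> X"
  shows "(\<Sum>x\<in>A. \<Sum>y\<in>B. cnj (c x) * d y * K x y) = (\<Sum>x\<in>A. cnj (c x) * kernel_comb X K B d x)"
  using assms by (intro sum.cong refl) (auto simp: kernel_comb_in sum_distrib_left mult.assoc)

lemma kernel_form_left:
  assumes "A \<subseteq> X" "B \<subseteq> X"
  shows "(\<Sum>x\<in>A. \<Sum>y\<in>B. cnj (c x) * d y * K x y) = (\<Sum>y\<in>B. d y * cnj (kernel_comb X K A c y))"
proof -
  have "(\<Sum>x\<in>A. \<Sum>y\<in>B. cnj (c x) * d y * K x y) = (\<Sum>y\<in>B. \<Sum>x\<in>A. cnj (c x) * d y * K x y)"
    by (rule sum.swap)
  also have "\<dots> = (\<Sum>y\<in>B. \<Sum>x\<in>A. d y * cnj (c x * K y x))"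
    using assms by (intro sum.cong refl) (auto simp: kernel_hermitian[symmetric] subset_iff)
  also have "\<dots> = (\<Sum>y\<in>B. d y * cnj (kernel_comb X K A c y))"
    using assms by (intro sum.cong refl) (auto simp: kernel_comb_in sum_distrib_left)
  finally show ?thesis .
qed

text \<open>
  Independence of the representations: the double sum depends on its right argument only through
  the values of that function, and likewise for the left one, so a representation of either
  argument can be exchanged while the other is kept.
\<close>

lemma span_inner_kernel_comb:
  assumes "finite A" "A \<subseteq> X" "g \<in> kernel_span X K"
  shows "span_inner X K (kernel_comb X K A c) g = (\<Sum>x\<in>A. cnj (c x) * g x)"
proof -
  obtain B d where B: "finite B" "B \<subseteq> X" "g = kernel_comb X K B d"
    using assms(3) by (auto simp: kernel_span_def)
  show ?thesis
    unfolding span_inner_def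
  proof (rule the_equality)
    show "\<exists>A' c' B' d'. finite A' \<and> A' \<subseteq> X \<and> kernel_comb X K A c = kernel_comb X K A' c' \<and>
        finite B' \<and> B' \<subseteq> X \<and> g = kernel_comb X K B' d' \<and>
        (\<Sum>x\<in>A. cnj (c x) * g x) = (\<Sum>x\<in>A'. \<Sum>y\<in>B'. cnj (c' x) * d' y * K x y)"
      by (rule exI[of _ A], rule exI[of _ c], rule exI[of _ B], rule exI[of _ d])
        (simp add: assms(1,2) B kernel_form_right)
  next
    fix s
    assume "\<exists>A' c' B' d'. finite A' \<and> A' \<subseteq> X \<and> kernel_comb X K A c = kernel_comb X K A' c' \<and>
        finite B' \<and> B' \<subseteq> X \<and> g = kernel_comb X K B' d' \<and>
        s = (\<Sum>x\<in>A'. \<Sum>y\<in>B'. cnj (c' x) * d' y * K x y)"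
    then obtain A' c' B' d' where *: "A' \<subseteq> X" "kernel_comb X K A c = kernel_comb X K A' c'"
        "B' \<subseteq> X" "g = kernel_comb X K B' d'"
        and s: "s = (\<Sum>x\<in>A'. \<Sum>y\<in>B'. cnj (c' x) * d' y * K x y)"
      by (elim exE conjE) (rule that)
    have "s = (\<Sum>y\<in>B'. d' y * cnj (kernel_comb X K A c y))"
      unfolding s kernel_form_left[OF *(1,3)] *(2) ..
    also have "\<dots> = (\<Sum>x\<in>A. \<Sum>y\<in>B'. cnj (c x) * d' y * K x y)"
      by (rule kernel_form_left[OF assms(2) *(3), symmetric])
    also have "\<dots> = (\<Sum>x\<in>A. cnj (c x) * g x)"
      unfolding *(4) by (rule kernel_form_right[OF assms(2)])
    finally show "s = (\<Sum>x\<in>A. cnj (c x) * g x)" .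
  qed
qed

lemma span_inner_commute:
  assumes "f \<in> kernel_span X K" "g \<in> kernel_span X K"
  shows "span_inner X K f g = cnj (span_inner X K g f)"
proof -
  obtain A c where A: "finite A" "A \<subseteq> X" "f = kernel_comb X K A c"
    using assms(1) by (auto simp: kernel_span_def)
  obtain B d where B: "finite B" "B \<subseteq> X" "g = kernel_comb X K B d"
    using assms(2) by (auto simp: kernel_span_def)
  have "span_inner X K f g = (\<Sum>x\<in>A. cnj (c x) * kernel_comb X K B d x)"
    unfolding A(3) span_inner_kernel_comb[OF A(1,2) assms(2)] by (simp add: B(3))
  also have "\<dots> = (\<Sum>y\<in>B. d y * cnj (f y))"
    unfolding A(3) kernel_form_right[OF A(2), symmetric] by (rule kernel_form_left[OF A(2) B(2)])
  finally have "span_inner X K f g = (\<Sum>y\<in>B. d y * cnj (f y))" .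
  moreover have "span_inner X K g f = (\<Sum>y\<in>B. cnj (d y) * f y)"
    using span_inner_kernel_comb[OF B(1,2) assms(1)] B(3) by simp
  ultimately show ?thesis
    by simp
qed

text \<open>
  Families rather than sets of nodes: coefficients of coinciding nodes are added up. This is
  what makes repeated sample points harmless.
\<close>

lemma kernel_family_eq_kernel_comb:
  assumes "finite I"
  shows "(\<lambda>z. \<Sum>i\<in>I. a i * kernel_fun X K (t i) z) =
    kernel_comb X K (t ` I) (\<lambda>x. \<Sum>i\<in>{i\<in>I. t i = x}. a i)"
proof
  fix z
  have "kernel_comb X K (t ` I) (\<lambda>x. \<Sum>i\<in>{i\<in>I. t i = x}. a i) z =
      (\<Sum>x\<in>t ` I. \<Sum>i\<in>{i\<in>I. t i = x}. a i * kernel_fun X K (t i) z)"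
    unfolding kernel_comb_def sum_distrib_right by (intro sum.cong refl) auto
  also have "\<dots> = (\<Sum>i\<in>I. a i * kernel_fun X K (t i) z)"
    using assms by (intro sum.group) auto
  finally show "(\<Sum>i\<in>I. a i * kernel_fun X K (t i) z) =
      kernel_comb X K (t ` I) (\<lambda>x. \<Sum>i\<in>{i\<in>I. t i = x}. a i) z" ..
qed

lemma kernel_family_in_span:
  assumes "finite I" "\<And>i. i \<in> I \<Longrightarrow> t i \<in> X"
  shows "(\<lambda>z. \<Sum>i\<in>I. a i * kernel_fun X K (t i) z) \<in> kernel_span X K"
  unfolding kernel_family_eq_kernel_comb[OF assms(1)] kernel_span_def using assms by blast

lemma span_inner_kernel_family:
  assumes "finite I" "\<And>i. i \<in> I \<Longrightarrow> t i \<in> X" "g \<in> kernel_span X K"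
  shows "span_inner X K (\<lambda>z. \<Sum>i\<in>I. a i * kernel_fun X K (t i) z) g = (\<Sum>i\<in>I. cnj (a i) * g (t i))"
proof -
  have "span_inner X K (\<lambda>z. \<Sum>i\<in>I. a i * kernel_fun X K (t i) z) g =
      (\<Sum>x\<in>t ` I. cnj (\<Sum>i\<in>{i\<in>I. t i = x}. a i) * g x)"
    unfolding kernel_family_eq_kernel_comb[OF assms(1)]
    using assms by (intro span_inner_kernel_comb) auto
  also have "\<dots> = (\<Sum>x\<in>t ` I. \<Sum>i\<in>{i\<in>I. t i = x}. cnj (a i) * g (t i))"
    unfolding cnj_sum sum_distrib_right by (intro sum.cong refl) auto
  also have "\<dots> = (\<Sum>i\<in>I. cnj (a i) * g (t i))"
    using assms by (intro sum.group) auto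
  finally show ?thesis .
qed

lemma kernel_span_combine:
  assumes "f \<in> kernel_span X K" "g \<in> kernel_span X K"
  shows "(\<lambda>z. f z + k * g z) \<in> kernel_span X K"
proof -
  obtain A c where A: "finite A" "A \<subseteq> X" "f = kernel_comb X K A c"
    using assms(1) by (auto simp: kernel_span_def)
  obtain B d where B: "finite B" "B \<subseteq> X" "g = kernel_comb X K B d"
    using assms(2) by (auto simp: kernel_span_def)
  define I where "I = Inl ` A \<union> Inr ` B"
  define a where "a = case_sum c (\<lambda>y. k * d y)"
  define p where "p = case_sum (\<lambda>x::'a. x) (\<lambda>y. y)"
  have "(\<lambda>z. \<Sum>i\<in>I. a i * kernel_fun X K (p i) z) \<in> kernel_span X K"
    using A B by (intro kernel_family_in_span) (auto simp: I_def p_def)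
  also have "(\<lambda>z. \<Sum>i\<in>I. a i * kernel_fun X K (p i) z) = (\<lambda>z. f z + k * g z)"
    unfolding I_def A(3) B(3) kernel_comb_def a_def p_def using A(1) B(1)
    by (subst sum.union_disjoint) (auto simp: sum.reindex sum_distrib_left mult.assoc)
  finally show ?thesis .
qed

lemma kernel_span_diff:
  assumes "f \<in> kernel_span X K" "g \<in> kernel_span X K"
  shows "(\<lambda>z. f z - g z) \<in> kernel_span X K"
  using kernel_span_combine[OF assms, of "-1"] by simp

lemma span_inner_combine_right:
  assumes "f \<in> kernel_span X K" "g \<in> kernel_span X K" "h \<in> kernel_span X K"
  shows "span_inner X K f (\<lambda>z. g z + k * h z) = span_inner X K f g + k * span_inner X K f h"
proof -
  obtain A c where A: "finite A" "A \<subseteq> X" "f = kernel_comb X K A c"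
    using assms(1) by (auto simp: kernel_span_def)
  show ?thesis
    unfolding A(3) using A assms
    by (simp add: span_inner_kernel_comb kernel_span_combine algebra_simps sum.distrib
        sum_distrib_left)
qed

lemma span_inner_combine_left:
  assumes "f \<in> kernel_span X K" "g \<in> kernel_span X K" "h \<in> kernel_span X K"
  shows "span_inner X K (\<lambda>z. g z + k * h z) f = span_inner X K g f + cnj k * span_inner X K h f"
  using assms
  by (simp add: span_inner_commute[of _ f] kernel_span_combine span_inner_combine_right)

lemma span_inner_diff_right:
  assumes "f \<in> kernel_span X K" "g \<in> kernel_span X K" "h \<in> kernel_span X K"
  shows "span_inner X K f (\<lambda>z. g z - h z) = span_inner X K f g - span_inner X K f h"
  using span_inner_combine_right[OF assms, of "-1"] by simp

lemma span_inner_diff_left: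
  assumes "f \<in> kernel_span X K" "g \<in> kernel_span X K" "h \<in> kernel_span X K"
  shows "span_inner X K (\<lambda>z. g z - h z) f = span_inner X K g f - span_inner X K h f"
  using span_inner_combine_left[OF assms, of "-1"] by simp

lemma span_inner_self_nonneg:
  assumes "f \<in> kernel_span X K"
  shows "span_inner X K f f \<in> \<real>\<^sub>\<ge>\<^sub>0"
proof -
  obtain A c where A: "finite A" "A \<subseteq> X" "f = kernel_comb X K A c"
    using assms by (auto simp: kernel_span_def)
  have "span_inner X K f f = (\<Sum>x\<in>A. cnj (c x) * f x)"
    using span_inner_kernel_comb[OF A(1,2) assms, of c] A(3) by simp
  also have "\<dots> = (\<Sum>x\<in>A. \<Sum>y\<in>A. cnj (c x) * c y * K x y)"
    unfolding A(3) by (rule kernel_form_right[OF A(2), symmetric])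
  finally have "span_inner X K f f = (\<Sum>x\<in>A. \<Sum>y\<in>A. cnj (c x) * c y * K x y)" .
  then show ?thesis
    using kernel_form_nonneg[OF A(1), of "\<lambda>x. x" c] A(2) by auto
qed

lemma span_inner_self:
  assumes "f \<in> kernel_span X K"
  shows "span_inner X K f f = complex_of_real ((span_norm X K f)\<^sup>2)"
  using span_inner_self_nonneg[OF assms]
  by (auto simp: span_norm_def complex_nonneg_Reals_iff complex_eq_iff)

lemma span_norm_nonneg:
  assumes "f \<in> kernel_span X K"
  shows "0 \<le> span_norm X K f"
  using span_inner_self_nonneg[OF assms] by (simp add: span_norm_def complex_nonneg_Reals_iff)

section \<open>Seminorm inequalities on the span\<close>

text \<open>
  The form is not yet known to be definite, so \<open>\<parallel>g\<parallel> = 0\<close> cannot be excluded and needs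
  a separate choice of the multiple of \<open>g\<close> that is subtracted from \<open>f\<close>.
\<close>

lemma span_cauchy_schwarz:
  assumes f: "f \<in> kernel_span X K" and g: "g \<in> kernel_span X K"
  shows "cmod (span_inner X K f g) \<le> span_norm X K f * span_norm X K g"
proof -
  define b where "b = span_inner X K f g"
  define p where "p = (span_norm X K f)\<^sup>2"
  define q where "q = (span_norm X K g)\<^sup>2"
  \<comment> \<open>A real multiple of \<open>cnj b\<close> as coefficient of \<open>g\<close> turns both cross terms into
     \<open>- r \<bar>b\<bar>\<^sup>2\<close>.\<close>
  have quad: "0 \<le> p - 2 * r * (cmod b)\<^sup>2 + r\<^sup>2 * (cmod b)\<^sup>2 * q" for r :: real
  proof -
    define k where "k = - complex_of_real r * cnj b"
    define w where "w = (\<lambda>z. f z + k * g z)"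
    have w: "w \<in> kernel_span X K"
      unfolding w_def using f g by (rule kernel_span_combine)
    have gf: "span_inner X K g f = cnj b"
      unfolding b_def by (rule span_inner_commute[OF g f])
    have "span_inner X K w w = span_inner X K w f + k * span_inner X K w g"
      by (subst (2) w_def) (rule span_inner_combine_right[OF w f g])
    also have "\<dots> = (p + cnj k * cnj b) + k * (b + cnj k * q)"
      unfolding w_def using f g gf
      by (simp add: span_inner_combine_left span_inner_self p_def q_def b_def[symmetric])
    also have "\<dots> = complex_of_real (p - 2 * r * (cmod b)\<^sup>2 + r\<^sup>2 * (cmod b)\<^sup>2 * q)"
      unfolding k_def of_real_add of_real_diff of_real_mult complex_norm_square
      by (simp add: algebra_simps power2_eq_square complex_norm_square)
    finally show ?thesis
      using span_inner_self_nonneg[OF w] by (metis nonneg_Reals_of_real_iff)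
  qed
  have "(cmod b)\<^sup>2 \<le> p * q"
  proof (cases "q = 0")
    case True
    have "b = 0"
    proof (rule ccontr)
      assume "b \<noteq> 0"
      then show False
        using quad[of "(p + 1) / (2 * (cmod b)\<^sup>2)"] True by (simp add: field_simps)
    qed
    then show ?thesis
      using True by simp
  next
    case False
    then have "q > 0"
      by (simp add: q_def)
    then show ?thesis
      using quad[of "1 / q"] by (simp add: field_simps power2_eq_square)
  qed
  then have "(cmod b)\<^sup>2 \<le> (span_norm X K f * span_norm X K g)\<^sup>2"
    by (simp add: p_def q_def power_mult_distrib)
  then show ?thesis
    unfolding b_def by (rule power2_le_imp_le) (simp add: span_norm_nonneg f g)
qed

lemma span_norm_diff_sq:
  assumes "f \<in> kernel_span X K" "g \<in> kernel_span X K"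
  shows "(span_norm X K (\<lambda>z. f z - g z))\<^sup>2 =
    (span_norm X K f)\<^sup>2 - 2 * Re (span_inner X K g f) + (span_norm X K g)\<^sup>2"
proof -
  have "complex_of_real ((span_norm X K (\<lambda>z. f z - g z))\<^sup>2) =
      span_inner X K (\<lambda>z. f z - g z) (\<lambda>z. f z - g z)"
    using assms by (simp add: span_inner_self kernel_span_diff)
  also have "\<dots> = complex_of_real ((span_norm X K f)\<^sup>2) - span_inner X K g f
      - cnj (span_inner X K g f) + complex_of_real ((span_norm X K g)\<^sup>2)"
    using assms span_inner_commute[OF assms]
    by (simp add: span_inner_diff_left span_inner_diff_right kernel_span_diff span_inner_self)
  finally show ?thesis
    by (simp add: complex_eq_iff)
qed

lemma span_norm_triangle:
  assumes "f \<in> kernel_span X K" "g \<in> kernel_span X K"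
  shows "span_norm X K (\<lambda>z. f z - g z) \<le> span_norm X K f + span_norm X K g"
    and "\<bar>span_norm X K f - span_norm X K g\<bar> \<le> span_norm X K (\<lambda>z. f z - g z)"
proof -
  have cs: "\<bar>Re (span_inner X K g f)\<bar> \<le> span_norm X K f * span_norm X K g"
    using span_cauchy_schwarz[OF assms(2,1)] abs_Re_le_cmod[of "span_inner X K g f"]
    by (simp add: mult.commute)
  have "(span_norm X K (\<lambda>z. f z - g z))\<^sup>2 \<le> (span_norm X K f + span_norm X K g)\<^sup>2"
    using cs unfolding span_norm_diff_sq[OF assms] power2_sum by linarith
  then show "span_norm X K (\<lambda>z. f z - g z) \<le> span_norm X K f + span_norm X K g"
    by (rule power2_le_imp_le) (simp add: span_norm_nonneg assms)
  have "\<bar>span_norm X K f - span_norm X K g\<bar>\<^sup>2 \<le> (span_norm X K (\<lambda>z. f z - g z))\<^sup>2"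
    using cs unfolding span_norm_diff_sq[OF assms] power2_abs power2_diff by linarith
  then show "\<bar>span_norm X K f - span_norm X K g\<bar> \<le> span_norm X K (\<lambda>z. f z - g z)"
    by (rule power2_le_imp_le) (simp add: span_norm_nonneg kernel_span_diff assms)
qed

text \<open>
  By the reproducing property \<open>f x\<close> is the inner product of \<open>K(\<cdot>, x)\<close> with \<open>f\<close>, so evaluation at a
  point is bounded.
\<close>

lemma kernel_span_eval_bound:
  assumes "f \<in> kernel_span X K" "x \<in> X"
  shows "cmod (f x) \<le> span_norm X K (kernel_fun X K x) * span_norm X K f"
proof -
  have *: "kernel_fun X K x \<in> kernel_span X K"
    using kernel_family_in_span[of "{x}" "\<lambda>x. x" "\<lambda>_. 1"] assms(2) by simp
  have "f x = span_inner X K (kernel_fun X K x) f"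
    using span_inner_kernel_family[of "{x}" "\<lambda>x. x" f "\<lambda>_. 1"] assms by simp
  then show ?thesis
    using span_cauchy_schwarz[OF * assms(1)] by simp
qed

section \<open>The norm of the completion\<close>

lemma rkhs_approxD:
  assumes "rkhs_approx X K u f"
  shows "u n \<in> kernel_span X K"
    and "0 < e \<Longrightarrow> \<exists>N. \<forall>m\<ge>N. \<forall>n\<ge>N. span_norm X K (\<lambda>z. u m z - u n z) < e"
    and "(\<lambda>n. u n z) \<longlonglongrightarrow> f z"
  using assms by (auto simp: rkhs_approx_def)

lemma rkhs_approx_const:
  assumes "f \<in> kernel_span X K"
  shows "rkhs_approx X K (\<lambda>_. f) f"
proof -
  have "span_norm X K (\<lambda>z. f z - f z) = 0"
    using span_norm_diff_sq[OF assms assms] by (simp add: span_inner_self[OF assms])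
  then show ?thesis
    using assms by (simp add: rkhs_approx_def)
qed

lemma rkhs_approx_diff:
  assumes u: "rkhs_approx X K u f" and v: "rkhs_approx X K v g"
  shows "rkhs_approx X K (\<lambda>n z. u n z - v n z) (\<lambda>z. f z - g z)"
  unfolding rkhs_approx_def
proof (intro conjI allI impI)
  show "(\<lambda>z. u n z - v n z) \<in> kernel_span X K" for n
    using rkhs_approxD(1)[OF u] rkhs_approxD(1)[OF v] by (rule kernel_span_diff)
  show "(\<lambda>n. u n z - v n z) \<longlonglongrightarrow> f z - g z" for z
    using rkhs_approxD(3)[OF u] rkhs_approxD(3)[OF v] by (rule tendsto_diff)
  fix e :: real assume "e > 0"
  then have "e / 2 > 0" by simp
  obtain N1 where N1: "\<forall>m\<ge>N1. \<forall>n\<ge>N1. span_norm X K (\<lambda>z. u m z - u n z) < e / 2"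
    using rkhs_approxD(2)[OF u \<open>e / 2 > 0\<close>] by blast
  obtain N2 where N2: "\<forall>m\<ge>N2. \<forall>n\<ge>N2. span_norm X K (\<lambda>z. v m z - v n z) < e / 2"
    using rkhs_approxD(2)[OF v \<open>e / 2 > 0\<close>] by blast
  have "span_norm X K (\<lambda>z. (u m z - v m z) - (u n z - v n z)) < e"
    if "m \<ge> max N1 N2" "n \<ge> max N1 N2" for m n
  proof -
    have "span_norm X K (\<lambda>z. (u m z - v m z) - (u n z - v n z)) =
        span_norm X K (\<lambda>z. (u m z - u n z) - (v m z - v n z))"
      by (simp add: algebra_simps)
    also have "\<dots> \<le> span_norm X K (\<lambda>z. u m z - u n z) + span_norm X K (\<lambda>z. v m z - v n z)"
      by (intro span_norm_triangle(1) kernel_span_diff rkhs_approxD(1)[OF u] rkhs_approxD(1)[OF v])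
    also have "\<dots> < e"
      using N1[rule_format, of m n] N2[rule_format, of m n] that by simp
    finally show ?thesis .
  qed
  then show "\<exists>N. \<forall>m\<ge>N. \<forall>n\<ge>N. span_norm X K (\<lambda>z. (u m z - v m z) - (u n z - v n z)) < e"
    by blast
qed

lemma rkhs_approx_norm_convergent:
  assumes u: "rkhs_approx X K u f"
  shows "convergent (\<lambda>n. span_norm X K (u n))"
proof -
  have "Cauchy (\<lambda>n. span_norm X K (u n))"
  proof (rule CauchyI)
    fix e :: real assume "e > 0"
    then obtain N where N: "\<forall>m\<ge>N. \<forall>n\<ge>N. span_norm X K (\<lambda>z. u m z - u n z) < e"
      using rkhs_approxD(2)[OF u] by blast
    show "\<exists>M. \<forall>m\<ge>M. \<forall>n\<ge>M. norm (span_norm X K (u m) - span_norm X K (u n)) < e"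
      using N span_norm_triangle(2)[OF rkhs_approxD(1)[OF u] rkhs_approxD(1)[OF u]]
      by (metis le_less_trans real_norm_def)
  qed
  then show ?thesis
    by (simp add: Cauchy_convergent_iff)
qed

text \<open>
  Fix \<open>N\<close> far out in the sequence and split
  \<open>\<parallel>w\<^sub>n\<parallel>\<^sup>2 = \<langle>w\<^sub>N, w\<^sub>n\<rangle> + \<langle>w\<^sub>n - w\<^sub>N, w\<^sub>n\<rangle>\<close>. The second part is small since the sequence is bounded and
  Cauchy. The first part is a fixed finite combination of values of \<open>w\<^sub>n\<close>, because \<open>w\<^sub>N\<close> lies in
  the span, and so tends to \<open>0\<close>.
\<close>

lemma null_approx_norm:
  assumes w: "rkhs_approx X K w (\<lambda>_. 0)"
  shows "(\<lambda>n. span_norm X K (w n)) \<longlonglongrightarrow> 0"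
proof -
  note span = rkhs_approxD(1)[OF w]
  obtain C where C: "C > 0" "\<And>n. span_norm X K (w n) \<le> C"
    using convergent_imp_Bseq[OF rkhs_approx_norm_convergent[OF w]]
    by (metis BseqE abs_le_D1 real_norm_def)
  have "(\<lambda>n. (span_norm X K (w n))\<^sup>2) \<longlonglongrightarrow> 0"
  proof (rule LIMSEQ_I)
    fix e :: real assume e: "e > 0"
    then have "e / (2 * C) > 0"
      using C by simp
    then obtain N where N: "\<forall>m\<ge>N. \<forall>n\<ge>N. span_norm X K (\<lambda>z. w m z - w n z) < e / (2 * C)"
      using rkhs_approxD(2)[OF w] by blast
    obtain A c where A: "finite A" "A \<subseteq> X" "w N = kernel_comb X K A c"
      using span[of N] by (auto simp: kernel_span_def)
    have "(\<lambda>n. \<Sum>x\<in>A. cnj (c x) * w n x) \<longlonglongrightarrow> (\<Sum>x\<in>A. cnj (c x) * 0)"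
      by (intro tendsto_intros rkhs_approxD(3)[OF w])
    then have "(\<lambda>n. span_inner X K (w N) (w n)) \<longlonglongrightarrow> 0"
      unfolding A(3) by (simp add: span_inner_kernel_comb[OF A(1,2) span])
    then obtain N' where N': "\<And>n. n \<ge> N' \<Longrightarrow> cmod (span_inner X K (w N) (w n)) < e / 2"
      using LIMSEQ_D[of _ 0 "e / 2"] e by force
    have "(span_norm X K (w n))\<^sup>2 < e" if "n \<ge> max N N'" for n
    proof -
      have "(span_norm X K (w n))\<^sup>2 = cmod (span_inner X K (w n) (w n))"
        by (simp add: span_inner_self[OF span] norm_power)
      also have "\<dots> = cmod (span_inner X K (w N) (w n) +
          span_inner X K (\<lambda>z. w n z - w N z) (w n))"
        by (simp add: span_inner_diff_left span)
      also have "\<dots> \<le> cmod (span_inner X K (w N) (w n)) +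
          span_norm X K (\<lambda>z. w n z - w N z) * span_norm X K (w n)"
        using norm_triangle_ineq span_cauchy_schwarz[OF kernel_span_diff[OF span span] span]
        by (meson add_left_mono order_trans)
      also have "\<dots> < e / 2 + e / (2 * C) * C"
      proof (rule add_less_le_mono)
        show "cmod (span_inner X K (w N) (w n)) < e / 2"
          using N' that by simp
        show "span_norm X K (\<lambda>z. w n z - w N z) * span_norm X K (w n) \<le> e / (2 * C) * C"
          using N[rule_format, of n N] that C e span_norm_nonneg[OF span]
          by (intro mult_mono) auto
      qed
      also have "\<dots> = e"
        using C by simp
      finally show ?thesis .
    qed
    then show "\<exists>no. \<forall>n\<ge>no. norm ((span_norm X K (w n))\<^sup>2 - 0) < e"
      by (intro exI[of _ "max N N'"]) simp
  qed
  then have "(\<lambda>n. sqrt ((span_norm X K (w n))\<^sup>2)) \<longlonglongrightarrow> sqrt 0"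
    by (rule tendsto_real_sqrt)
  then show ?thesis
    by (simp add: span_norm_nonneg[OF span])
qed

text \<open>
  Any two sequences \<open>v, w\<close> representing \<open>f\<close> differ from \<open>u\<close> by null sequences, so
  \<open>\<langle>v\<^sub>n, w\<^sub>n\<rangle> - \<langle>u\<^sub>n, u\<^sub>n\<rangle> = \<langle>v\<^sub>n - u\<^sub>n, w\<^sub>n\<rangle> + \<langle>u\<^sub>n, w\<^sub>n - u\<^sub>n\<rangle>\<close> tends to \<open>0\<close>. The description of
  \<open>\<langle>f, f\<rangle>\<close> as the limit along some pair of sequences is therefore unambiguous.
\<close>

lemma rkhs_norm_sq_limit:
  assumes u: "rkhs_approx X K u f"
  shows "(\<lambda>n. (span_norm X K (u n))\<^sup>2) \<longlonglongrightarrow> (rkhs_norm X K f)\<^sup>2"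
proof -
  obtain l where l: "(\<lambda>n. span_norm X K (u n)) \<longlonglongrightarrow> l"
    using rkhs_approx_norm_convergent[OF u] by (auto simp: convergent_def)
  have lim: "(\<lambda>n. span_inner X K (v n) (w n)) \<longlonglongrightarrow> complex_of_real (l\<^sup>2)"
    if v: "rkhs_approx X K v f" and w: "rkhs_approx X K w f" for v w
  proof -
    note span = rkhs_approxD(1)[OF u] rkhs_approxD(1)[OF v] rkhs_approxD(1)[OF w]
    obtain l' where l': "(\<lambda>n. span_norm X K (w n)) \<longlonglongrightarrow> l'"
      using rkhs_approx_norm_convergent[OF w] by (auto simp: convergent_def)
    have vu: "(\<lambda>n. span_norm X K (\<lambda>z. v n z - u n z)) \<longlonglongrightarrow> 0"
      using rkhs_approx_diff[OF v u] by (intro null_approx_norm) simp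
    have wu: "(\<lambda>n. span_norm X K (\<lambda>z. w n z - u n z)) \<longlonglongrightarrow> 0"
      using rkhs_approx_diff[OF w u] by (intro null_approx_norm) simp
    have "(\<lambda>n. span_inner X K (\<lambda>z. v n z - u n z) (w n)) \<longlonglongrightarrow> 0"
    proof (rule Lim_null_comparison)
      show "\<forall>\<^sub>F n in sequentially. norm (span_inner X K (\<lambda>z. v n z - u n z) (w n)) \<le>
          span_norm X K (\<lambda>z. v n z - u n z) * span_norm X K (w n)"
        by (intro always_eventually allI span_cauchy_schwarz kernel_span_diff span)
      show "(\<lambda>n. span_norm X K (\<lambda>z. v n z - u n z) * span_norm X K (w n)) \<longlonglongrightarrow> 0"
        using tendsto_mult[OF vu l'] by simp
    qed
    moreover have "(\<lambda>n. span_inner X K (u n) (\<lambda>z. w n z - u n z)) \<longlonglongrightarrow> 0"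
    proof (rule Lim_null_comparison)
      show "\<forall>\<^sub>F n in sequentially. norm (span_inner X K (u n) (\<lambda>z. w n z - u n z)) \<le>
          span_norm X K (u n) * span_norm X K (\<lambda>z. w n z - u n z)"
        by (intro always_eventually allI span_cauchy_schwarz kernel_span_diff span)
      show "(\<lambda>n. span_norm X K (u n) * span_norm X K (\<lambda>z. w n z - u n z)) \<longlonglongrightarrow> 0"
        using tendsto_mult[OF l wu] by simp
    qed
    moreover have "(\<lambda>n. complex_of_real ((span_norm X K (u n))\<^sup>2)) \<longlonglongrightarrow> complex_of_real (l\<^sup>2)"
      by (intro tendsto_intros l)
    ultimately have "(\<lambda>n. span_inner X K (\<lambda>z. v n z - u n z) (w n) +
        span_inner X K (u n) (\<lambda>z. w n z - u n z) +
        complex_of_real ((span_norm X K (u n))\<^sup>2)) \<longlonglongrightarrow> 0 + 0 + complex_of_real (l\<^sup>2)"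
      by (intro tendsto_add)
    then show ?thesis
      by (simp add: span_inner_diff_left span_inner_diff_right span
          span_inner_self[symmetric] del: of_real_power)
  qed
  have "rkhs_inner X K f f = complex_of_real (l\<^sup>2)"
    unfolding rkhs_inner_def using lim u by (blast intro: the_equality LIMSEQ_unique)
  then have "(rkhs_norm X K f)\<^sup>2 = l\<^sup>2"
    by (simp add: rkhs_norm_def)
  then show ?thesis
    using tendsto_power[OF l, of 2] by simp
qed

lemma rkhs_norm_definite:
  assumes "f \<in> rkhs X K" "rkhs_norm X K f = 0"
  shows "f z = 0"
proof -
  obtain u where u: "rkhs_approx X K u f"
    using assms(1) by (auto simp: rkhs_def)
  note span = rkhs_approxD(1)[OF u]
  have "(\<lambda>n. (span_norm X K (u n))\<^sup>2) \<longlonglongrightarrow> 0"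
    using rkhs_norm_sq_limit[OF u] assms(2) by simp
  then have "(\<lambda>n. sqrt ((span_norm X K (u n))\<^sup>2)) \<longlonglongrightarrow> sqrt 0"
    by (rule tendsto_real_sqrt)
  then have norm0: "(\<lambda>n. span_norm X K (u n)) \<longlonglongrightarrow> 0"
    by (simp add: span_norm_nonneg[OF span])
  have "(\<lambda>n. u n z) \<longlonglongrightarrow> 0"
  proof (cases "z \<in> X")
    case True
    show ?thesis
    proof (rule Lim_null_comparison)
      show "\<forall>\<^sub>F n in sequentially. norm (u n z) \<le>
          span_norm X K (kernel_fun X K z) * span_norm X K (u n)"
        by (intro always_eventually allI kernel_span_eval_bound span True)
      show "(\<lambda>n. span_norm X K (kernel_fun X K z) * span_norm X K (u n)) \<longlonglongrightarrow> 0"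
        using tendsto_mult_left[OF norm0] by simp
    qed
  next
    case False
    then show ?thesis
      by (simp add: kernel_span_outside[OF span])
  qed
  then show ?thesis
    using rkhs_approxD(3)[OF u] by (blast intro: LIMSEQ_unique)
qed

text \<open>
  The identity \<open>\<parallel>f\<parallel>\<^sup>2 = \<parallel>F\<parallel>\<^sup>2 + 2 Re \<langle>F, f - F\<rangle> + \<parallel>f - F\<parallel>\<^sup>2\<close> with the inner product written out by the
  reproducing property. Every term is continuous along sequences in the span, where the identity
  is algebra.
\<close>

lemma rkhs_norm_sq_expansion:
  fixes a :: "'i \<Rightarrow> complex"
  assumes f: "f \<in> rkhs X K" and I: "finite I" "\<And>i. i \<in> I \<Longrightarrow> t i \<in> X"
  defines "F \<equiv> (\<lambda>z. \<Sum>i\<in>I. a i * kernel_fun X K (t i) z)"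
  shows "(rkhs_norm X K f)\<^sup>2 = (rkhs_norm X K F)\<^sup>2 +
    2 * Re (\<Sum>i\<in>I. cnj (a i) * (f (t i) - F (t i))) + (rkhs_norm X K (\<lambda>z. f z - F z))\<^sup>2"
proof -
  obtain u where u: "rkhs_approx X K u f"
    using f by (auto simp: rkhs_def)
  have F: "F \<in> kernel_span X K"
    unfolding F_def using I by (rule kernel_family_in_span)
  note span = rkhs_approxD(1)[OF u]
  note const = rkhs_approx_const[OF F]
  have normF: "(rkhs_norm X K F)\<^sup>2 = (span_norm X K F)\<^sup>2"
    using rkhs_norm_sq_limit[OF const] LIMSEQ_unique tendsto_const by blast
  have step: "(span_norm X K (u n))\<^sup>2 = (span_norm X K F)\<^sup>2 +
      2 * Re (\<Sum>i\<in>I. cnj (a i) * (u n (t i) - F (t i))) + (span_norm X K (\<lambda>z. u n z - F z))\<^sup>2" for n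
  proof -
    have "(\<Sum>i\<in>I. cnj (a i) * (u n (t i) - F (t i))) = span_inner X K F (\<lambda>z. u n z - F z)"
      unfolding F_def
      by (rule span_inner_kernel_family[OF I kernel_span_diff[OF span F], unfolded F_def,
            symmetric])
    also have "\<dots> = span_inner X K F (u n) - (span_norm X K F)\<^sup>2"
      by (simp add: span_inner_diff_right span_inner_self F span)
    finally show ?thesis
      using span_norm_diff_sq[OF span F, of n] by simp
  qed
  have "(\<lambda>n. (span_norm X K F)\<^sup>2 + 2 * Re (\<Sum>i\<in>I. cnj (a i) * (u n (t i) - F (t i))) +
      (span_norm X K (\<lambda>z. u n z - F z))\<^sup>2) \<longlonglongrightarrow>
      (span_norm X K F)\<^sup>2 + 2 * Re (\<Sum>i\<in>I. cnj (a i) * (f (t i) - F (t i))) +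
      (rkhs_norm X K (\<lambda>z. f z - F z))\<^sup>2"
    by (intro tendsto_intros rkhs_approxD(3)[OF u]
        rkhs_norm_sq_limit[OF rkhs_approx_diff[OF u const]])
  then have "(\<lambda>n. (span_norm X K (u n))\<^sup>2) \<longlonglongrightarrow>
      (span_norm X K F)\<^sup>2 + 2 * Re (\<Sum>i\<in>I. cnj (a i) * (f (t i) - F (t i))) +
      (rkhs_norm X K (\<lambda>z. f z - F z))\<^sup>2"
    unfolding step .
  then show ?thesis
    unfolding normF using rkhs_norm_sq_limit[OF u] by (blast intro: LIMSEQ_unique)
qed

section \<open>The regularized least squares problem\<close>

lemma regularized_sample_matrix_mult:
  "((sample_matrix K t + \<beta> *\<^sub>R mat 1) *v v) $ i =
    (\<Sum>j\<in>UNIV. K (t i) (t j) * v $ j) + of_real \<beta> * v $ i"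
proof -
  have "((sample_matrix K t + \<beta> *\<^sub>R mat 1) *v v) $ i =
      (\<Sum>j\<in>UNIV. K (t i) (t j) * v $ j + (if i = j then of_real \<beta> * v $ j else 0))"
    unfolding matrix_vector_mult_def sample_matrix_def mat_def
    by (auto simp: distrib_right scaleR_conv_of_real[where 'a = complex] intro!: sum.cong)
  then show ?thesis
    by (simp add: sum.distrib)
qed

lemma invertible_regularized_sample_matrix:
  fixes t :: "'m::finite \<Rightarrow> 'a" and \<beta> :: real
  assumes t: "\<And>i. t i \<in> X" and \<beta>: "\<beta> > 0"
  shows "invertible (sample_matrix K t + \<beta> *\<^sub>R mat 1)"
proof -
  have "v = 0" if v: "(sample_matrix K t + \<beta> *\<^sub>R mat 1) *v v = 0" for v
  proof -
    have row: "(\<Sum>j\<in>UNIV. K (t i) (t j) * v $ j) + of_real \<beta> * v $ i = 0" for i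
      using v regularized_sample_matrix_mult[of t \<beta> v i] by simp
    have "(\<Sum>i\<in>UNIV. cnj (v $ i) * ((\<Sum>j\<in>UNIV. K (t i) (t j) * v $ j) + of_real \<beta> * v $ i)) = 0"
      by (simp add: row)
    then have "(\<Sum>i\<in>UNIV. \<Sum>j\<in>UNIV. cnj (v $ i) * v $ j * K (t i) (t j)) +
        complex_of_real (\<beta> * (\<Sum>i\<in>UNIV. (cmod (v $ i))\<^sup>2)) = 0"
      by (simp add: algebra_simps sum.distrib sum_distrib_left complex_norm_square
          del: of_real_power)
    moreover have "(\<Sum>i\<in>UNIV. \<Sum>j\<in>UNIV. cnj (v $ i) * v $ j * K (t i) (t j)) \<in> \<real>\<^sub>\<ge>\<^sub>0"
      using t by (intro kernel_form_nonneg) auto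
    ultimately have "\<beta> * (\<Sum>i\<in>UNIV. (cmod (v $ i))\<^sup>2) \<le> 0"
      by (auto simp: complex_nonneg_Reals_iff complex_eq_iff)
    then have "(\<Sum>i\<in>UNIV. (cmod (v $ i))\<^sup>2) \<le> 0"
      using \<beta> by (simp add: mult_le_0_iff)
    then have "(\<Sum>i\<in>UNIV. (cmod (v $ i))\<^sup>2) = 0"
      by (intro antisym sum_nonneg) auto
    then have "\<forall>i. v $ i = 0"
      by (subst (asm) sum_nonneg_eq_0_iff) auto
    then show "v = 0"
      by (simp add: vec_eq_iff)
  qed
  then show ?thesis
    by (simp add: invertible_left_inverse matrix_left_invertible_ker)
qed

text \<open>
  The hypothesis \<open>res\<close> is the linear system \<open>(K\<^sub>m + \<beta> I) a = y\<close>, read row by row as a statement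
  about residuals. With \<open>h = f - F\<close>, it makes the cross term of the data misfit,
  \<open>- 2 Re (\<Sum>i. cnj (\<beta> a\<^sub>i) h (t\<^sub>i))\<close>, the negative of the cross term of the penalty.
\<close>

lemma regularized_loss_expansion:
  fixes t :: "'m::finite \<Rightarrow> 'a" and y :: "real ^ 'm" and a :: "'m \<Rightarrow> complex"
  assumes f: "f \<in> rkhs X K" and t: "\<And>i. t i \<in> X"
  defines "F \<equiv> (\<lambda>z. \<Sum>i\<in>UNIV. a i * kernel_fun X K (t i) z)"
  assumes res: "\<And>i. complex_of_real (y $ i) - F (t i) = of_real \<beta> * a i"
  shows "regularized_loss X K t y \<beta> f = regularized_loss X K t y \<beta> F +
    (\<Sum>i\<in>UNIV. (cmod (f (t i) - F (t i)))\<^sup>2) + \<beta> * (rkhs_norm X K (\<lambda>z. f z - F z))\<^sup>2"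
proof -
  have point: "(cmod (complex_of_real (y $ i) - f (t i)))\<^sup>2 =
      (cmod (complex_of_real (y $ i) - F (t i)))\<^sup>2
      - 2 * \<beta> * Re (cnj (a i) * (f (t i) - F (t i))) + (cmod (f (t i) - F (t i)))\<^sup>2" for i
  proof -
    define h where "h = f (t i) - F (t i)"
    have eq: "complex_of_real (y $ i) - f (t i) = of_real \<beta> * a i - h"
      using res[of i] by (simp add: h_def algebra_simps)
    show ?thesis
      unfolding eq res h_def[symmetric] cmod_power2
      by (simp add: algebra_simps power2_eq_square)
  qed
  have "(rkhs_norm X K f)\<^sup>2 = (rkhs_norm X K F)\<^sup>2 +
      2 * Re (\<Sum>i\<in>UNIV. cnj (a i) * (f (t i) - F (t i))) + (rkhs_norm X K (\<lambda>z. f z - F z))\<^sup>2"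
    unfolding F_def by (rule rkhs_norm_sq_expansion[OF f]) (use t in auto)
  moreover have "(\<Sum>i\<in>UNIV. (cmod (complex_of_real (y $ i) - f (t i)))\<^sup>2) =
      (\<Sum>i\<in>UNIV. (cmod (complex_of_real (y $ i) - F (t i)))\<^sup>2)
      - 2 * \<beta> * Re (\<Sum>i\<in>UNIV. cnj (a i) * (f (t i) - F (t i)))
      + (\<Sum>i\<in>UNIV. (cmod (f (t i) - F (t i)))\<^sup>2)"
    unfolding point Re_sum sum_distrib_left by (simp only: sum.distrib sum_subtractf)
  ultimately show ?thesis
    by (simp only: regularized_loss_def distrib_left)
qed

end

theorem theorem2p6:
  fixes X :: "'a set"
    and K :: "'a \<Rightarrow> 'a \<Rightarrow> complex"
    and t :: "'m::finite \<Rightarrow> 'a"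
    and y :: "real ^ 'm"
    and \<beta> :: real
  assumes "positive_definite_kernel X K"
    and "\<And>i. t i \<in> X"
    and "\<beta> > 0"
  defines "M \<equiv> sample_matrix K t + \<beta> *\<^sub>R mat 1"
  defines "F \<equiv> (\<lambda>z. \<Sum>i\<in>UNIV.
              (matrix_inv M *v (\<chi> j. complex_of_real (y $ j))) $ i * kernel_fun X K (t i) z)"
  shows "invertible M \<and>
         (\<forall>f. is_arg_min (regularized_loss X K t y \<beta>) (\<lambda>f. f \<in> rkhs X K) f \<longleftrightarrow> f = F)"
proof
  interpret pd_kernel X K
    using assms(1) by unfold_locales
  show inv: "invertible M"
    unfolding M_def using assms(2,3) by (rule invertible_regularized_sample_matrix)
  define a where "a = matrix_inv M *v (\<chi> j. complex_of_real (y $ j))"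
  have F: "F = (\<lambda>z. \<Sum>i\<in>UNIV. a $ i * kernel_fun X K (t i) z)"
    by (simp add: F_def a_def)
  have "M ** matrix_inv M = mat 1"
    unfolding matrix_inv_def using someI_ex[OF inv[unfolded invertible_def]] by blast
  then have Ma: "M *v a = (\<chi> j. complex_of_real (y $ j))"
    by (simp add: a_def matrix_vector_mul_assoc)
  have res: "complex_of_real (y $ i) - F (t i) = of_real \<beta> * a $ i" for i
    using regularized_sample_matrix_mult[of t \<beta> a i, folded M_def] assms(2)
    by (simp add: Ma F kernel_fun_def mult.commute[of "a $ _"])
  have F_rkhs: "F \<in> rkhs X K"
  proof -
    have "F \<in> kernel_span X K"
      unfolding F using assms(2) by (intro kernel_family_in_span) auto
    then show ?thesis
      unfolding rkhs_def using rkhs_approx_const by blast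
  qed
  have expansion: "regularized_loss X K t y \<beta> f = regularized_loss X K t y \<beta> F +
      (\<Sum>i\<in>UNIV. (cmod (f (t i) - F (t i)))\<^sup>2) + \<beta> * (rkhs_norm X K (\<lambda>z. f z - F z))\<^sup>2"
    if "f \<in> rkhs X K" for f
    unfolding F
    by (rule regularized_loss_expansion[OF that assms(2)]) (rule res[unfolded F])
  have le: "regularized_loss X K t y \<beta> F \<le> regularized_loss X K t y \<beta> f" if "f \<in> rkhs X K" for f
    unfolding expansion[OF that] using assms(3) by (simp add: sum_nonneg)
  have unique: "f = F"
    if f: "f \<in> rkhs X K" and "regularized_loss X K t y \<beta> f \<le> regularized_loss X K t y \<beta> F" for f
  proof -
    have "(\<Sum>i\<in>UNIV. (cmod (f (t i) - F (t i)))\<^sup>2) + \<beta> * (rkhs_norm X K (\<lambda>z. f z - F z))\<^sup>2 \<le> 0"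
      using that(2) unfolding expansion[OF f] by simp
    moreover have "0 \<le> (\<Sum>i\<in>UNIV. (cmod (f (t i) - F (t i)))\<^sup>2)"
      by (simp add: sum_nonneg)
    ultimately have "\<beta> * (rkhs_norm X K (\<lambda>z. f z - F z))\<^sup>2 \<le> 0"
      by linarith
    then have norm0: "rkhs_norm X K (\<lambda>z. f z - F z) = 0"
      using assms(3) by (simp add: mult_le_0_iff)
    have "(\<lambda>z. f z - F z) \<in> rkhs X K"
      using f F_rkhs rkhs_approx_diff unfolding rkhs_def by blast
    then have "f z - F z = 0" for z
      using rkhs_norm_definite norm0 by blast
    then show "f = F"
      by auto
  qed
  show "\<forall>f. is_arg_min (regularized_loss X K t y \<beta>) (\<lambda>f. f \<in> rkhs X K) f \<longleftrightarrow> f = F"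
    unfolding is_arg_min_def using le unique F_rkhs by (meson not_le)
qed

end
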